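(* Let $(\Omega,\mathcal F,\mathsf P)$ be a probability space, let $p\in(0,1)$, and let $B_1,B_2,\dots$ be an infinite sequence of independent events in $\mathcal F$ such that $\mathsf P(B_i)=p$ for all $i\in\mathbb N=\{1,2,\dots\}$. Let $A\in\mathcal F$ be an event, and suppose that for some $q\in(0,1)$ $$\frac1n\sum_{i\in[n]}\mathsf P(A\mid B_i)\to q\quad\text{as } n\to\infty,$$ where $[n]:=\{1,\dots,n\}$. Then $\mathsf P(A)=q$.
   Context: An event is a member of the $\sigma$-algebra $\mathcal F$. Independence of the sequence $(B_i)_{i\in\mathbb N}$ means mutual independence. $\mathsf P(A\mid B)=\mathsf P(A\cap B)/\mathsf P(B)$ for events $A,B$ with $\mathsf P(B)>0$. *)

theory Defs
  imports "HOL-Probability.Probability"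
begin

end

theory Submission
  imports Defs
begin

text \<open>
  The sum \<open>S\<close> of \<open>n\<close> centred indicators of the \<open>B\<^sub>i\<close> is a sum of orthogonal variables, so its second
  moment is only \<open>n p (1 - p)\<close>. By Cauchy--Schwarz the correlation \<open>E(1\<^sub>A S)\<close> of \<open>S\<close> with the
  indicator of any fixed event \<open>A\<close> is therefore at most of order \<open>\<surd>n\<close>
  (lemma \<open>sum_centered_correlation_bound\<close>). That correlation is \<open>p\<close> times the sum of the differences
  \<open>P(A | B\<^sub>i) - P(A)\<close>, hence the Cesaro mean of these differences has square at most
  \<open>(1 - p) / (p n)\<close> and tends to \<open>0\<close>. So the Cesaro means of \<open>P(A | B\<^sub>i)\<close> always
  converge to \<open>P(A)\<close>, and \<open>q\<close> must be that limit.
\<close>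

context prob_space
begin

text \<open>Pairwise independence annihilates all off-diagonal terms of the squared sum.\<close>

lemma centered_indicator_sum_second_moment:
  fixes B :: "'i \<Rightarrow> 'a set" and p :: real
  assumes I: "finite I"
    and B: "\<And>i. i \<in> I \<Longrightarrow> B i \<in> events"
    and prob_B: "\<And>i. i \<in> I \<Longrightarrow> prob (B i) = p"
    and pairwise: "\<And>i j. i \<in> I \<Longrightarrow> j \<in> I \<Longrightarrow> i \<noteq> j \<Longrightarrow> prob (B i \<inter> B j) = p * p"
  shows "expectation (\<lambda>\<omega>. (\<Sum>i\<in>I. indicator (B i) \<omega> - p)\<^sup>2) = real (card I) * (p * (1 - p))"
proof -
  let ?X = "\<lambda>i \<omega>. indicator (B i) \<omega> - p :: real"
  have product: "?X i \<omega> * ?X j \<omega>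
      = indicator (B i \<inter> B j) \<omega> - p * indicator (B i) \<omega> - p * indicator (B j) \<omega> + p * p" for i j \<omega>
    by (simp add: indicator_inter_arith algebra_simps)
  have integrable_ind: "integrable M (indicator C :: 'a \<Rightarrow> real)" if "C \<in> events" for C
    using that by (simp add: emeasure_eq_measure)
  have integrable_product: "integrable M (\<lambda>\<omega>. ?X i \<omega> * ?X j \<omega>)" if "i \<in> I" "j \<in> I" for i j
    unfolding product using that B
    by (intro Bochner_Integration.integrable_add Bochner_Integration.integrable_diff
        integrable_mult_right integrable_ind integrable_const) auto
  have covariance: "expectation (\<lambda>\<omega>. ?X i \<omega> * ?X j \<omega>) = (if i = j then p * (1 - p) else 0)"
    if "i \<in> I" "j \<in> I" for i j
  proof -
    have "expectation (\<lambda>\<omega>. ?X i \<omega> * ?X j \<omega>) = prob (B i \<inter> B j) - p * prob (B i) - p * prob (B j) + p * p"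
      unfolding product using that B integrable_ind
      by (simp add: prob_space sets.Int)
    then show ?thesis
      using that prob_B pairwise by (cases "i = j") (simp_all add: right_diff_distrib)
  qed
  have "expectation (\<lambda>\<omega>. (\<Sum>i\<in>I. ?X i \<omega>)\<^sup>2) = expectation (\<lambda>\<omega>. \<Sum>i\<in>I. \<Sum>j\<in>I. ?X i \<omega> * ?X j \<omega>)"
    by (simp only: power2_eq_square sum_product)
  also have "\<dots> = (\<Sum>i\<in>I. \<Sum>j\<in>I. expectation (\<lambda>\<omega>. ?X i \<omega> * ?X j \<omega>))"
    by (subst Bochner_Integration.integral_sum;
        (intro Bochner_Integration.integrable_sum sum.cong refl Bochner_Integration.integral_sum)?)
       (auto intro: integrable_product)
  also have "\<dots> = (\<Sum>i\<in>I. \<Sum>j\<in>I. if i = j then p * (1 - p) else 0)"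
    by (intro sum.cong refl covariance)
  also have "\<dots> = real (card I) * (p * (1 - p))"
    using I by simp
  finally show ?thesis .
qed

text \<open>
  Cauchy--Schwarz against the indicator of \<open>A\<close>, in the form \<open>(E Y)\<^sup>2 \<le> E(Y\<^sup>2)\<close> for the centred sum
  \<open>Y\<close> restricted to \<open>A\<close>. The gain is that the bound is linear in the number of events, whereas
  the square of a sum of that many terms could be quadratic.
\<close>

lemma sum_centered_correlation_bound:
  fixes B :: "'i \<Rightarrow> 'a set" and p :: real
  assumes I: "finite I"
    and A: "A \<in> events"
    and B: "\<And>i. i \<in> I \<Longrightarrow> B i \<in> events"
    and prob_B: "\<And>i. i \<in> I \<Longrightarrow> prob (B i) = p"
    and pairwise: "\<And>i j. i \<in> I \<Longrightarrow> j \<in> I \<Longrightarrow> i \<noteq> j \<Longrightarrow> prob (B i \<inter> B j) = p * p"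
  shows "(\<Sum>i\<in>I. prob (A \<inter> B i) - p * prob A)\<^sup>2 \<le> real (card I) * (p * (1 - p))"
proof -
  define S :: "'a \<Rightarrow> real" where "S \<omega> = (\<Sum>i\<in>I. indicator (B i) \<omega> - p)" for \<omega>
  define Y :: "'a \<Rightarrow> real" where "Y \<omega> = indicator A \<omega> * S \<omega>" for \<omega>
  have S_meas [measurable]: "S \<in> borel_measurable M"
    unfolding S_def using B by (intro borel_measurable_sum) auto
  have Y_meas [measurable]: "Y \<in> borel_measurable M"
    unfolding Y_def using A by measurable
  have S_bound: "\<bar>S \<omega>\<bar> \<le> real (card I) * (1 + \<bar>p\<bar>)" for \<omega>
  proof -
    have "\<bar>S \<omega>\<bar> \<le> (\<Sum>i\<in>I. \<bar>indicator (B i) \<omega> - p\<bar>)"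
      unfolding S_def by (rule sum_abs)
    also have "\<dots> \<le> (\<Sum>i\<in>I. 1 + \<bar>p\<bar>)"
      by (intro sum_mono) (auto simp: indicator_def)
    finally show ?thesis by simp
  qed
  have Y_le_S: "\<bar>Y \<omega>\<bar> \<le> \<bar>S \<omega>\<bar>" for \<omega>
    by (simp add: Y_def indicator_def)
  have integrable_S2: "integrable M (\<lambda>\<omega>. (S \<omega>)\<^sup>2)"
    by (rule integrable_const_bound[where B = "(real (card I) * (1 + \<bar>p\<bar>))\<^sup>2"])
       (use S_bound in \<open>auto simp: abs_le_square_iff[symmetric]\<close>)
  have Y2_le_S2: "(Y \<omega>)\<^sup>2 \<le> (S \<omega>)\<^sup>2" for \<omega>
    using Y_le_S by (simp add: abs_le_square_iff)
  have integrable_Y2: "integrable M (\<lambda>\<omega>. (Y \<omega>)\<^sup>2)"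
    by (rule Bochner_Integration.integrable_bound[OF integrable_S2]) (use Y2_le_S2 in auto)
  have integrable_Y: "integrable M Y"
    by (rule integrable_const_bound[where B = "real (card I) * (1 + \<bar>p\<bar>)"])
       (use order_trans[OF Y_le_S S_bound] in auto)
  have "expectation Y = expectation (\<lambda>\<omega>. \<Sum>i\<in>I. indicator (A \<inter> B i) \<omega> - p * indicator A \<omega>)"
    by (intro Bochner_Integration.integral_cong refl)
       (simp add: Y_def S_def sum_distrib_left indicator_inter_arith algebra_simps)
  also have "\<dots> = (\<Sum>i\<in>I. prob (A \<inter> B i) - p * prob A)"
    using A B
    by (subst Bochner_Integration.integral_sum)
       (auto simp: emeasure_eq_measure sets.Int intro!: sum.cong Bochner_Integration.integrable_diff)
  finally have "(\<Sum>i\<in>I. prob (A \<inter> B i) - p * prob A)\<^sup>2 = (expectation Y)\<^sup>2"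
    by simp
  also have "\<dots> \<le> expectation (\<lambda>\<omega>. (Y \<omega>)\<^sup>2)"
    using variance_eq[OF integrable_Y integrable_Y2] variance_positive[of Y] by simp
  also have "\<dots> \<le> expectation (\<lambda>\<omega>. (S \<omega>)\<^sup>2)"
    by (intro integral_mono integrable_Y2 integrable_S2 Y2_le_S2)
  also have "\<dots> = real (card I) * (p * (1 - p))"
    unfolding S_def by (rule centered_indicator_sum_second_moment[OF I B prob_B pairwise])
  finally show ?thesis .
qed

end

theorem theorem2:
  fixes M :: "'a measure" and A :: "'a set" and B :: "nat \<Rightarrow> 'a set" and p q :: real
  assumes "prob_space M"
    and "0 < p" and "p < 1"
    and "\<And>i. i \<ge> 1 \<Longrightarrow> B i \<in> sets M"
    and "prob_space.indep_events M B {1..}"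
    and "\<And>i. i \<ge> 1 \<Longrightarrow> measure M (B i) = p"
    and "A \<in> sets M"
    and "0 < q" and "q < 1"
    and "(\<lambda>n::nat. (1 / real n) * (\<Sum>i=1..n. \<P>(\<omega> in M. \<omega> \<in> A \<bar> \<omega> \<in> B i))) \<longlonglongrightarrow> q"
  shows "measure M A = q"
proof -
  interpret prob_space M by fact
  define c where "c n = (1 / real n) * (\<Sum>i=1..n. \<P>(\<omega> in M. \<omega> \<in> A \<bar> \<omega> \<in> B i))" for n :: nat
  have pairwise: "prob (B i \<inter> B j) = p * p" if "i \<ge> 1" "j \<ge> 1" "i \<noteq> j" for i j
  proof -
    have "prob (\<Inter>k\<in>{i, j}. B k) = (\<Prod>k\<in>{i, j}. prob (B k))"
      using assms(5) that unfolding indep_events_def by (metis (no_types, lifting)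
          atLeast_iff empty_iff empty_not_insert finite.emptyI finite.insertI insert_iff subsetI)
    then show ?thesis
      using that assms(6) by simp
  qed
  have cond: "\<P>(\<omega> in M. \<omega> \<in> A \<bar> \<omega> \<in> B i) = prob (A \<inter> B i) / p" if "i \<ge> 1" for i
  proof -
    have "{\<omega> \<in> space M. \<omega> \<in> A \<and> \<omega> \<in> B i} = A \<inter> B i" "{\<omega> \<in> space M. \<omega> \<in> B i} = B i"
      using assms(4)[OF that] assms(7) sets.sets_into_space by blast+
    then show ?thesis
      using assms(6)[OF that] by (simp add: cond_prob_def)
  qed
  have error_bound: "(c n - prob A)\<^sup>2 \<le> (1 - p) / p / real n" if "n > 0" for n
  proof -
    have "c n - prob A = (\<Sum>i=1..n. prob (A \<inter> B i) - p * prob A) / (real n * p)"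
      using that \<open>0 < p\<close>
      by (simp add: c_def cond sum_subtractf sum_divide_distrib[symmetric] field_simps)
    then have "(c n - prob A)\<^sup>2
        = (\<Sum>i=1..n. prob (A \<inter> B i) - p * prob A)\<^sup>2 / (real n * p)\<^sup>2"
      by (simp add: power_divide)
    also have "\<dots> \<le> real n * (p * (1 - p)) / (real n * p)\<^sup>2"
      using sum_centered_correlation_bound[of "{1..n}" A B p] assms(4,6,7) pairwise
      by (intro divide_right_mono) auto
    also have "\<dots> = (1 - p) / p / real n"
      using that \<open>0 < p\<close> by (simp add: field_simps power2_eq_square)
    finally show ?thesis .
  qed
  have bound_tendsto: "(\<lambda>n. (1 - p) / p / real n) \<longlonglongrightarrow> 0"
    by (rule lim_const_over_n)
  have "(\<lambda>n. (c n - prob A)\<^sup>2) \<longlonglongrightarrow> 0"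
    by (rule tendsto_sandwich[OF _ _ tendsto_const bound_tendsto])
       (use error_bound in \<open>auto intro: eventually_sequentiallyI[of 1]\<close>)
  then have "(\<lambda>n. c n - prob A) \<longlonglongrightarrow> 0"
    by (simp add: tendsto_null_power)
  then have "c \<longlonglongrightarrow> prob A"
    by (simp add: LIM_zero_iff)
  then show ?thesis
    using assms(10) LIMSEQ_unique unfolding c_def by blast
qed

end
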